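(* A curve $C\in|\mathcal{O}(2,2)|$ on $\mathbb{P}^1\times\mathbb{P}^1$ is GIT-stable with respect to the natural $\mathrm{SL}_2\times\mathrm{SL}_2$-action on $\mathbb{P}H^0(\mathbb{P}^1\times\mathbb{P}^1,\mathcal{O}(2,2))$ if and only if $C$ is smooth.
   Context: A biconic curve is a divisor $C\in|\mathcal{O}(2,2)|$ on $\mathbb{P}^1_{[X:U]}\times\mathbb{P}^1_{[Y:V]}$, given by $f=\sum_{0\le i,j\le2}a_{ij}X^iY^jU^{2-i}V^{2-j}$. GIT-stability is with respect to the linearized action of $\mathrm{SL}_2\times\mathrm{SL}_2$. *)

theory Defs
  imports "HOL-Analysis.Analysis"
begin

(* A (2,2)-form f = sum_{i,j<=2} a i j X^i Y^j U^(2-i) V^(2-j) is encoded by its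
   coefficient array a :: nat => nat => complex, supported on {0..2} x {0..2}. *)
type_synonym coeffs = "nat \<Rightarrow> nat \<Rightarrow> complex"

definition bideg22_space :: "coeffs set" where
  "bideg22_space = {a. \<forall>i j. (2 < i \<or> 2 < j) \<longrightarrow> a i j = 0}"

(* evaluation of the form at ([X:U],[Y:V]) with p = (X,U), q = (Y,V) *)
definition form22 :: "coeffs \<Rightarrow> complex^2 \<Rightarrow> complex^2 \<Rightarrow> complex" where
  "form22 a p q = (\<Sum>i\<le>2. \<Sum>j\<le>2. a i j * (p$1)^i * (p$2)^(2-i) * (q$1)^j * (q$2)^(2-j))"

definition dX22 :: "coeffs \<Rightarrow> complex^2 \<Rightarrow> complex^2 \<Rightarrow> complex" where
  "dX22 a p q = (\<Sum>i\<le>2. \<Sum>j\<le>2. a i j * of_nat i * (p$1)^(i-1) * (p$2)^(2-i) * (q$1)^j * (q$2)^(2-j))"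
definition dU22 :: "coeffs \<Rightarrow> complex^2 \<Rightarrow> complex^2 \<Rightarrow> complex" where
  "dU22 a p q = (\<Sum>i\<le>2. \<Sum>j\<le>2. a i j * of_nat (2-i) * (p$1)^i * (p$2)^(1-i) * (q$1)^j * (q$2)^(2-j))"
definition dY22 :: "coeffs \<Rightarrow> complex^2 \<Rightarrow> complex^2 \<Rightarrow> complex" where
  "dY22 a p q = (\<Sum>i\<le>2. \<Sum>j\<le>2. a i j * of_nat j * (p$1)^i * (p$2)^(2-i) * (q$1)^(j-1) * (q$2)^(2-j))"
definition dV22 :: "coeffs \<Rightarrow> complex^2 \<Rightarrow> complex^2 \<Rightarrow> complex" where
  "dV22 a p q = (\<Sum>i\<le>2. \<Sum>j\<le>2. a i j * of_nat (2-j) * (p$1)^i * (p$2)^(2-i) * (q$1)^j * (q$2)^(1-j))"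

definition singular_point22 :: "coeffs \<Rightarrow> complex^2 \<Rightarrow> complex^2 \<Rightarrow> bool" where
  "singular_point22 a p q \<longleftrightarrow> p \<noteq> 0 \<and> q \<noteq> 0 \<and> form22 a p q = 0 \<and>
     dX22 a p q = 0 \<and> dU22 a p q = 0 \<and> dY22 a p q = 0 \<and> dV22 a p q = 0"

definition smooth_biconic :: "coeffs \<Rightarrow> bool" where
  "smooth_biconic a \<longleftrightarrow> (\<nexists>p q. singular_point22 a p q)"

definition SL2 :: "(complex^2^2) set" where
  "SL2 = {g. det g = 1}"

definition orbit22 :: "coeffs \<Rightarrow> coeffs set" where
  "orbit22 a = {b \<in> bideg22_space. \<exists>g\<in>SL2. \<exists>h\<in>SL2.
      \<forall>p q. form22 b p q = form22 a (g *v p) (h *v q)}"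

definition stabilizer22 :: "coeffs \<Rightarrow> ((complex^2^2) \<times> (complex^2^2)) set" where
  "stabilizer22 a = {(g,h). g \<in> SL2 \<and> h \<in> SL2 \<and>
      (\<forall>p q. form22 a (g *v p) (h *v q) = form22 a p q)}"

inductive_set poly_fun :: "(coeffs \<Rightarrow> complex) set" where
  const: "(\<lambda>_. c) \<in> poly_fun"
| coord: "(\<lambda>a. a i j) \<in> poly_fun"
| add: "p \<in> poly_fun \<Longrightarrow> q \<in> poly_fun \<Longrightarrow> (\<lambda>a. p a + q a) \<in> poly_fun"
| mult: "p \<in> poly_fun \<Longrightarrow> q \<in> poly_fun \<Longrightarrow> (\<lambda>a. p a * q a) \<in> poly_fun"

definition zariski_closed22 :: "coeffs set \<Rightarrow> bool" where
  "zariski_closed22 S \<longleftrightarrow> (\<exists>P \<subseteq> poly_fun. S = {b \<in> bideg22_space. \<forall>f\<in>P. f b = 0})"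

(* GIT (proper) stability of [a] in P H^0: closed orbit of the lift and finite stabilizer *)
definition git_stable22 :: "coeffs \<Rightarrow> bool" where
  "git_stable22 a \<longleftrightarrow> zariski_closed22 (orbit22 a) \<and> finite (stabilizer22 a)"

end

theory Submission
  imports Defs "HOL-Computational_Algebra.Fundamental_Theorem_Algebra"
begin

text \<open>
  The map \<open>(x, u) \<mapsto> w = (x\<^sup>2 - u\<^sup>2, \<i> (x\<^sup>2 + u\<^sup>2), 2 x u)\<close> parametrises the isotropic vectors of
  \<open>\<complex>\<^sup>3\<close> and carries the action of \<open>SL\<^sub>2\<close> to that of \<open>SO\<^sub>3(\<complex>)\<close>, so a \<open>(2,2)\<close>-form becomes
  \<open>w(p)\<^sup>T M w(q)\<close> for a \<open>3 \<times> 3\<close> matrix \<open>M\<close> on which \<open>SO\<^sub>3 \<times> SO\<^sub>3\<close> acts from both sides.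
  An isotropic eigenvector of the symmetric matrix \<open>S = M\<^sup>T M\<close> yields a singular point of the curve,
  and a multiple eigenvalue of \<open>S\<close> yields an isotropic eigenvector. Hence for a smooth curve \<open>S\<close> has
  three distinct eigenvalues, \<open>M\<close> has a singular value decomposition over \<open>\<complex>\<close>, the orbit is cut out
  by the eigenvalues of \<open>S\<close> and \<open>det M\<close>, and the stabiliser is finite because its image
  in \<open>SO\<^sub>3 \<times> SO\<^sub>3\<close> commutes with \<open>(M M\<^sup>T, S)\<close>, hence is diagonal with entries \<open>\<plusminus>1\<close> in eigenbases.
  Conversely, if the curve has a singular point, moved to \<open>X = Y = 0\<close>, the one-parameter group
  \<open>diag(t, 1/t)\<close> in both factors carries the form to a limit as \<open>t \<rightarrow> 0\<close>, and this limit is fixed by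
  that group; so the orbit is not closed or the stabiliser is infinite.
\<close>

subsection \<open>The complex orthogonal group\<close>

definition cdot :: "complex^3 \<Rightarrow> complex^3 \<Rightarrow> complex" where
  "cdot x y = x$1 * y$1 + x$2 * y$2 + x$3 * y$3"

definition ccross :: "complex^3 \<Rightarrow> complex^3 \<Rightarrow> complex^3" where
  "ccross x y = vector [x$2 * y$3 - x$3 * y$2, x$3 * y$1 - x$1 * y$3, x$1 * y$2 - x$2 * y$1]"

definition SO3 :: "(complex^3^3) set" where
  "SO3 = {T. transpose T ** T = mat 1 \<and> det T = 1}"

definition diag3 :: "complex^3 \<Rightarrow> complex^3^3" where
  "diag3 d = (\<chi> i j. if i = j then d$i else 0)"

lemmas mat3_simps = vec_eq_iff forall_3 matrix_matrix_mult_def matrix_vector_mult_def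
  transpose_def sum_3 mat_def

lemma cdot_commute: "cdot x y = cdot y x"
  by (simp add: cdot_def)

lemma cdot_scale [simp]: "cdot (c *s x) y = c * cdot x y" "cdot x (c *s y) = c * cdot x y"
  by (simp_all add: cdot_def algebra_simps)

lemma cdot_zero [simp]: "cdot 0 x = 0" "cdot x 0 = 0"
  by (simp_all add: cdot_def)

lemma cdot_diff_right: "cdot x (y - z) = cdot x y - cdot x z"
  by (simp add: cdot_def algebra_simps)

lemma cdot_matrix_left: "cdot (A *v x) y = cdot x (transpose A *v y)"
  by (simp add: cdot_def mat3_simps algebra_simps del: transpose_matrix_vector)

lemma SO3_D:
  assumes "T \<in> SO3"
  shows "transpose T ** T = mat 1" "T ** transpose T = mat 1" "det T = 1"
  using assms matrix_left_right_inverse1[of "transpose T" T] by (auto simp: SO3_def)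

lemma SO3_transpose:
  assumes "T \<in> SO3"
  shows "transpose T \<in> SO3"
  using SO3_D(2,3)[OF assms] by (simp add: SO3_def)

lemma SO3_mult:
  assumes "S \<in> SO3" "T \<in> SO3"
  shows "S ** T \<in> SO3"
proof -
  have "transpose (S ** T) ** (S ** T) = transpose T ** (transpose S ** S) ** T"
    unfolding matrix_transpose_mul matrix_mul_assoc ..
  also have "\<dots> = mat 1"
    unfolding SO3_D(1)[OF assms(1)] matrix_mul_rid SO3_D(1)[OF assms(2)] ..
  finally show ?thesis
    by (simp add: SO3_def det_mul SO3_D(3)[OF assms(1)] SO3_D(3)[OF assms(2)])
qed

lemma SO3_cdot:
  assumes "T \<in> SO3"
  shows "cdot (T *v x) (T *v y) = cdot x y"
  unfolding cdot_matrix_left matrix_vector_mul_assoc SO3_D(1)[OF assms] by simp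

text \<open>Pairing the left side with z gives the determinant of the columns Tx, Ty, Tz, which is
  \<open>det T\<close> times that of x, y, z.\<close>

lemma transpose_mult_ccross:
  "transpose T *v ccross (T *v x) (T *v y) = det T *s ccross x y"
  by (simp add: ccross_def mat3_simps det_3 del: transpose_matrix_vector,
      intro conjI) (simp_all add: algebra_simps)

lemma SO3_ccross:
  assumes "T \<in> SO3"
  shows "ccross (T *v x) (T *v y) = T *v ccross x y"
proof -
  have "T *v (transpose T *v ccross (T *v x) (T *v y)) = T *v ccross x y"
    unfolding transpose_mult_ccross SO3_D[OF assms] by simp
  then show ?thesis
    unfolding matrix_vector_mul_assoc SO3_D[OF assms] by simp
qed

subsection \<open>The spin covering\<close>

definition conic_pt :: "complex^2 \<Rightarrow> complex^3" where
  "conic_pt p = vector [(p$1)\<^sup>2 - (p$2)\<^sup>2, \<i> * ((p$1)\<^sup>2 + (p$2)\<^sup>2), 2 * p$1 * p$2]"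

text \<open>The partial derivatives of \<^const>\<open>conic_pt\<close>.\<close>

definition conicX :: "complex^2 \<Rightarrow> complex^3" where
  "conicX p = vector [2 * p$1, 2 * \<i> * p$1, 2 * p$2]"

definition conicU :: "complex^2 \<Rightarrow> complex^3" where
  "conicU p = vector [- 2 * p$2, 2 * \<i> * p$2, 2 * p$1]"

text \<open>The symmetric square of g in the coordinates of \<open>conic_pt\<close>; its entries are
  quadratic in those of g, so \<open>g\<close> and \<open>- g\<close> have the same image.\<close>

definition spin :: "complex^2^2 \<Rightarrow> complex^3^3" where
  "spin g = (let a = g$1$1; b = g$1$2; c = g$2$1; d = g$2$2 in
     vector [vector [(a\<^sup>2 - c\<^sup>2 - b\<^sup>2 + d\<^sup>2) / 2, - \<i> * (a\<^sup>2 - c\<^sup>2 + b\<^sup>2 - d\<^sup>2) / 2, a * b - c * d],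
             vector [\<i> * (a\<^sup>2 + c\<^sup>2 - b\<^sup>2 - d\<^sup>2) / 2, (a\<^sup>2 + c\<^sup>2 + b\<^sup>2 + d\<^sup>2) / 2, \<i> * (a * b + c * d)],
             vector [a * c - b * d, - \<i> * (a * c + b * d), a * d + b * c]])"

lemma conic_spin: "conic_pt (g *v p) = spin g *v conic_pt p"
  by (simp add: conic_pt_def spin_def mat3_simps sum_2 Let_def power2_eq_square)
     (simp add: field_simps)

text \<open>On conic points \<open>cdot\<close> is -2 times a squared 2x2 determinant
  (\<open>cdot_conic_conic\<close>), and g multiplies that determinant by
  \<open>det g\<close>.\<close>

lemma spin_orth: "transpose (spin g) ** spin g = mat ((det g)\<^sup>2)"
  by (simp add: spin_def mat3_simps sum_2 Let_def det_2)
     (simp add: field_simps power2_eq_square)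

text \<open>Orthogonality leaves the sign of the determinant open; this identity places the image of
  \<open>SL2\<close> in the special orthogonal group.\<close>

lemma det_spin: "det (spin g) = det g ^ 3"
  by (simp add: spin_def det_3 Let_def det_2)
     (simp add: field_simps power2_eq_square power3_eq_cube)

lemma spin_SO3: "g \<in> SL2 \<Longrightarrow> spin g \<in> SO3"
  by (simp add: SO3_def SL2_def spin_orth det_spin)

lemma cdot_conic_conic: "cdot (conic_pt p) (conic_pt q) = - 2 * (p$1 * q$2 - p$2 * q$1)\<^sup>2"
  by (simp add: cdot_def conic_pt_def power2_eq_square) (simp add: algebra_simps)

text \<open>The first two coordinates of m fix the squares of x and u. Isotropy then gives the third
  coordinate up to sign, and the sign is absorbed into u.\<close>

lemma isotropic_conic:
  assumes "cdot m m = 0"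
  obtains p where "m = conic_pt p"
proof -
  define x where "x = csqrt ((m$1 - \<i> * m$2) / 2)"
  define u where "u = csqrt ((- m$1 - \<i> * m$2) / 2)"
  have x: "x\<^sup>2 = (m$1 - \<i> * m$2) / 2" and u: "u\<^sup>2 = (- m$1 - \<i> * m$2) / 2"
    by (simp_all add: x_def u_def)
  have "(2 * x * u)\<^sup>2 = 4 * (x\<^sup>2 * u\<^sup>2)" by (simp add: power_mult_distrib)
  also have "\<dots> = - (m$1)\<^sup>2 - (m$2)\<^sup>2"
    unfolding x u by (simp add: field_simps power2_eq_square)
  also have "\<dots> = (m$3)\<^sup>2" using assms by (simp add: cdot_def power2_eq_square) algebra
  finally have "2 * x * u = m$3 \<or> 2 * x * (-u) = m$3"
    by (simp add: power2_eq_iff) (metis minus_minus)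
  then obtain v where v: "v\<^sup>2 = u\<^sup>2" "2 * x * v = m$3" by (metis power2_minus)
  have "m = conic_pt (vector [x, v])"
    by (simp add: conic_pt_def mat3_simps v x u) (simp add: field_simps)
  then show ?thesis by (rule that)
qed

lemma conic_uminus: "conic_pt (- p) = conic_pt p"
  by (simp add: conic_pt_def)

lemma conic_eq_0_iff: "conic_pt p = 0 \<longleftrightarrow> p = 0"
proof
  assume "conic_pt p = 0"
  then have "(p$1)\<^sup>2 - (p$2)\<^sup>2 = 0" "(p$1)\<^sup>2 + (p$2)\<^sup>2 = 0"
    by (auto simp: conic_pt_def vec_eq_iff forall_3)
  then have "(p$1)\<^sup>2 = 0" "(p$2)\<^sup>2 = 0" by algebra+
  then show "p = 0" by (simp add: vec_eq_iff forall_2)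
qed (simp add: conic_pt_def vec_eq_iff forall_3)

lemma conic_span:
  assumes "\<And>p. cdot (conic_pt p) y = 0"
  shows "y = 0"
  using assms[of "vector [1,0]"] assms[of "vector [0,1]"] assms[of "vector [1,1]"]
  by (simp add: conic_pt_def cdot_def vec_eq_iff forall_3)

text \<open>Conic points span the space (\<open>conic_span\<close>), so a biconic form determines
  its matrix.\<close>

lemma matrix_eq_on_conic:
  assumes "\<And>p q. cdot (conic_pt p) (M *v conic_pt q) = cdot (conic_pt p) (N *v conic_pt q)"
  shows "M = N"
proof -
  have *: "M *v conic_pt q = N *v conic_pt q" for q
    using conic_span[of "M *v conic_pt q - N *v conic_pt q"] assms by (simp add: cdot_diff_right)
  have "transpose M *v x = transpose N *v x" for x
    using conic_span[of "transpose M *v x - transpose N *v x"] *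
    by (simp add: cdot_diff_right flip: cdot_matrix_left del: transpose_matrix_vector)
  then show ?thesis by (metis matrix_eq transpose_transpose)
qed

text \<open>T maps the conic points of the two basis vectors to isotropic vectors, hence to conic
  points of some p and q. Preservation of \<open>cdot\<close> forces the determinant of (p, q) to be
  1 or -1, and replacing q by -q corrects the sign without moving its conic point. The matrix with
  columns p, q then agrees with T on two vectors and on their cross product, which together form a
  basis.\<close>

lemma spin_surj:
  assumes T: "T \<in> SO3"
  obtains g where "g \<in> SL2" "spin g = T"
proof -
  let ?e1 = "vector [1,0] :: complex^2" and ?e2 = "vector [0,1] :: complex^2"
  have iso: "cdot (T *v conic_pt p) (T *v conic_pt p) = 0" for p
    by (simp add: SO3_cdot[OF T] cdot_conic_conic)
  obtain p where p: "T *v conic_pt ?e1 = conic_pt p" using isotropic_conic[OF iso] by metis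
  obtain q0 where q0: "T *v conic_pt ?e2 = conic_pt q0" using isotropic_conic[OF iso] by metis
  have "(p$1 * q0$2 - p$2 * q0$1)\<^sup>2 = 1"
    using SO3_cdot[OF T, of "conic_pt ?e1" "conic_pt ?e2"] unfolding p q0 by (simp add: cdot_conic_conic)
  then consider "p$1 * q0$2 - p$2 * q0$1 = 1" | "p$1 * q0$2 - p$2 * q0$1 = -1"
    by (auto simp: power2_eq_1_iff)
  then obtain q where q: "T *v conic_pt ?e2 = conic_pt q" and d: "p$1 * q$2 - p$2 * q$1 = 1"
  proof cases
    case 2
    then show ?thesis using q0 by (intro that[of "- q0"]) (simp_all add: conic_uminus algebra_simps)
  qed (use that q0 in blast)
  define g :: "complex^2^2" where "g = vector [vector [p$1, q$1], vector [p$2, q$2]]"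
  have g: "g \<in> SL2" using d by (simp add: g_def SL2_def det_2 mult.commute)
  have ge: "g *v ?e1 = p" "g *v ?e2 = q"
    by (simp_all add: g_def matrix_vector_mult_def vec_eq_iff forall_2 sum_2)
  have 1: "spin g *v conic_pt ?e1 = T *v conic_pt ?e1" "spin g *v conic_pt ?e2 = T *v conic_pt ?e2"
    unfolding conic_spin[symmetric] ge p q by simp_all
  then have 2: "spin g *v ccross (conic_pt ?e1) (conic_pt ?e2) = T *v ccross (conic_pt ?e1) (conic_pt ?e2)"
    by (simp flip: SO3_ccross[OF T] SO3_ccross[OF spin_SO3[OF g]])
  have "spin g *v x = T *v x" for x
  proof -
    have "x = ((x$1 - \<i> * x$2) / 2) *s conic_pt ?e1 + ((- x$1 - \<i> * x$2) / 2) *s conic_pt ?e2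
        + (x$3 / (2 * \<i>)) *s ccross (conic_pt ?e1) (conic_pt ?e2)"
      by (simp add: conic_pt_def ccross_def vec_eq_iff forall_3 field_simps)
    then obtain a b c where x: "x = a *s conic_pt ?e1 + b *s conic_pt ?e2
        + c *s ccross (conic_pt ?e1) (conic_pt ?e2)" by (rule that)
    show ?thesis unfolding x vec.add vec.scale 1 2 ..
  qed
  then have "spin g = T" by (simp add: matrix_eq)
  then show ?thesis using g that by blast
qed

lemma finite_square_eq: "finite {x::complex. x\<^sup>2 = c}"
proof -
  have "{x. x\<^sup>2 = c} \<subseteq> {csqrt c, - csqrt c}"
    by (auto, metis power2_csqrt power2_eq_iff)
  then show ?thesis by (rule finite_subset) simp
qed


lemma finite_conic_fibre: "finite {p. conic_pt p = m}"
proof -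
  let ?x = "(m$1 - \<i> * m$2) / 2" and ?u = "(- m$1 - \<i> * m$2) / 2"
  have "{p. conic_pt p = m} \<subseteq> (\<lambda>(x,u). vector [x, u]) ` ({x. x\<^sup>2 = ?x} \<times> {u. u\<^sup>2 = ?u})"
  proof clarify
    fix p assume "m = conic_pt p"
    have "p = vector [p$1, p$2]" by (simp add: vec_eq_iff forall_2)
    moreover have "(p$1)\<^sup>2 = (conic_pt p$1 - \<i> * conic_pt p$2) / 2"
      "(p$2)\<^sup>2 = (- conic_pt p$1 - \<i> * conic_pt p$2) / 2"
      by (simp_all add: conic_pt_def field_simps)
    ultimately show "p \<in> (\<lambda>(x,u). vector [x, u]) `
        ({x. x\<^sup>2 = (conic_pt p$1 - \<i> * conic_pt p$2) / 2} \<times> {u. u\<^sup>2 = (- conic_pt p$1 - \<i> * conic_pt p$2) / 2})"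
      by (intro image_eqI[of _ _ "(p$1, p$2)"]) auto
  qed
  then show ?thesis
    by (rule finite_subset) (intro finite_imageI finite_cartesian_product finite_square_eq)
qed

text \<open>The columns of g have conic points prescribed by T, and each conic point has finitely
  many preimages.\<close>

lemma finite_spin_fibre: "finite {g. spin g = T}"
proof -
  let ?e1 = "vector [1,0] :: complex^2" and ?e2 = "vector [0,1] :: complex^2"
  let ?F = "\<lambda>m. {p. conic_pt p = m}"
  have "{g. spin g = T} \<subseteq> (\<lambda>(p,q). vector [vector [p$1, q$1], vector [p$2, q$2]]) ` 
          (?F (T *v conic_pt ?e1) \<times> ?F (T *v conic_pt ?e2))"
  proof clarify
    fix g :: "complex^2^2"
    let ?p = "g *v ?e1" and ?q = "g *v ?e2"
    have "g = vector [vector [?p$1, ?q$1], vector [?p$2, ?q$2]]"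
      by (simp add: vec_eq_iff forall_2 matrix_vector_mult_def sum_2)
    then show "g \<in> (\<lambda>(p,q). vector [vector [p$1, q$1], vector [p$2, q$2]]) ` 
          (?F (spin g *v conic_pt ?e1) \<times> ?F (spin g *v conic_pt ?e2))"
      by (intro image_eqI[of _ _ "(?p, ?q)"]) (simp_all add: conic_spin)
  qed
  then show ?thesis
    by (rule finite_subset) (intro finite_imageI finite_cartesian_product finite_conic_fibre)
qed

subsection \<open>Symmetric complex matrices\<close>

text \<open>The condition on p is the vanishing of a binary quadratic form, which has a nontrivial
  zero over the complex numbers.\<close>

lemma conic_orthogonal_exists:
  obtains p where "p \<noteq> 0" "cdot (conic_pt p) y = 0"
proof -
  define A B C where "A = y$1 + \<i> * y$2" and "B = y$3" and "C = - y$1 + \<i> * y$2"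
  have eq: "cdot (conic_pt p) y = A * (p$1)\<^sup>2 + 2 * B * p$1 * p$2 + C * (p$2)\<^sup>2" for p
    by (simp add: cdot_def conic_pt_def A_def B_def C_def algebra_simps)
  show ?thesis
  proof (cases "A = 0")
    case True
    show ?thesis
      by (rule that[of "vector [1,0]"]) (simp_all add: eq True vec_eq_iff forall_2)
  next
    case False
    define s where "s = csqrt (B\<^sup>2 - A * C)"
    have s: "s\<^sup>2 = B\<^sup>2 - A * C" by (simp add: s_def)
    have "A * ((s - B) / A)\<^sup>2 + 2 * B * ((s - B) / A) + C = (s\<^sup>2 - B\<^sup>2 + A * C) / A"
      using False by (simp add: field_simps power2_eq_square)
    also have "\<dots> = 0" by (simp add: s)
    finally show ?thesis
      by (intro that[of "vector [(s - B) / A, 1]"]) (simp_all add: eq vec_eq_iff forall_2)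
  qed
qed

section \<open>Adjugates and multiple eigenvalues\<close>

definition adj3 :: "complex^3^3 \<Rightarrow> complex^3^3" where
  "adj3 A = vector
    [vector [A$2$2 * A$3$3 - A$2$3 * A$3$2, A$1$3 * A$3$2 - A$1$2 * A$3$3, A$1$2 * A$2$3 - A$1$3 * A$2$2],
     vector [A$2$3 * A$3$1 - A$2$1 * A$3$3, A$1$1 * A$3$3 - A$1$3 * A$3$1, A$1$3 * A$2$1 - A$1$1 * A$2$3],
     vector [A$2$1 * A$3$2 - A$2$2 * A$3$1, A$1$2 * A$3$1 - A$1$1 * A$3$2, A$1$1 * A$2$2 - A$1$2 * A$2$1]]"

lemma mult_adj3: "A ** adj3 A = mat (det A)"
  by (simp add: adj3_def mat3_simps det_3, intro conjI) (simp_all add: algebra_simps)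

lemma trace_3: "trace (A :: complex^3^3) = A$1$1 + A$2$2 + A$3$3"
  by (simp add: trace_def sum_3)

lemma det_shift:
  "det (S - mat x) = - (x^3) + trace S * x\<^sup>2 - trace (adj3 S) * x + det (S :: complex^3^3)"
  by (simp add: det_3 trace_3 adj3_def mat_def power2_eq_square power3_eq_cube algebra_simps)

text \<open>By \<open>det_shift\<close> this is minus the derivative of
  \<open>det (S - mat x)\<close> in x, so it vanishes at an eigenvalue exactly when the root is
  multiple.\<close>

lemma trace_adj3_shift:
  "trace (adj3 (S - mat x)) = 3 * x\<^sup>2 - 2 * trace S * x + trace (adj3 S)"
  by (simp add: trace_3 adj3_def mat_def power2_eq_square algebra_simps)

lemma adj3_column:
  assumes sym: "transpose N = N" and det: "det N = 0"
  defines "k \<equiv> \<lambda>j. column j (adj3 N)"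
  shows "N *v k j = 0" and "cdot (k j) (k j) = trace (adj3 N) * adj3 N $ j $ j"
proof -
  have "N *v k j = column j (N ** adj3 N)"
    by (simp add: k_def column_def matrix_vector_mult_def matrix_matrix_mult_def)
  then show "N *v k j = 0"
    by (simp add: mult_adj3 det column_def mat_def vec_eq_iff)
  have s: "N$2$1 = N$1$2" "N$3$1 = N$1$3" "N$3$2 = N$2$3"
    by (subst sym[symmetric], simp add: transpose_def)+
  have D: "det N = N$1$1 * N$2$2 * N$3$3 + 2 * N$1$2 * N$2$3 * N$1$3
      - N$1$1 * (N$2$3)\<^sup>2 - N$2$2 * (N$1$3)\<^sup>2 - N$3$3 * (N$1$2)\<^sup>2"
    unfolding det_3 s by (simp add: algebra_simps power2_eq_square)
  \<comment> \<open>This is the diagonal of the Cayley-Hamilton relation for the symmetric matrix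
    \<open>adj3 N\<close>, using that the adjugate of the adjugate is \<open>det N\<close> times
    N.\<close>
  have "\<forall>j. cdot (k j) (k j) = trace (adj3 N) * adj3 N $ j $ j - det N * (trace N - N $ j $ j)"
    unfolding forall_3 D
    by (simp add: k_def column_def cdot_def trace_3 adj3_def s)
       (simp add: algebra_simps power2_eq_square)
  then show "cdot (k j) (k j) = trace (adj3 N) * adj3 N $ j $ j" by (simp add: det)
qed

text \<open>If the adjugate is nonzero, a nonzero column of it is an isotropic kernel vector by
  \<open>adj3_column\<close>. If it is zero, N has rank at most one, so being orthogonal to one
  nonzero row already puts a vector in the kernel, and a conic point with this property
  exists.\<close>

lemma isotropic_kernel_if_double_root:
  assumes sym: "transpose N = N" and det: "det N = 0" and tr: "trace (adj3 N) = 0"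
  obtains n where "n \<noteq> 0" "N *v n = 0" "cdot n n = 0"
proof (cases "adj3 N = 0")
  case False
  then obtain i j where "adj3 N $ i $ j \<noteq> 0" by (auto simp: vec_eq_iff)
  then have "column j (adj3 N) \<noteq> 0" by (auto simp: column_def vec_eq_iff)
  then show ?thesis
    using that adj3_column[OF sym det, of j] tr by simp
next
  case True
  have eqs: "N$2$2 * N$3$3 = N$2$3 * N$3$2" "N$1$3 * N$3$2 = N$1$2 * N$3$3"
    "N$1$2 * N$2$3 = N$1$3 * N$2$2" "N$2$3 * N$3$1 = N$2$1 * N$3$3" "N$1$1 * N$3$3 = N$1$3 * N$3$1"
    "N$1$3 * N$2$1 = N$1$1 * N$2$3" "N$2$1 * N$3$2 = N$2$2 * N$3$1" "N$1$2 * N$3$1 = N$1$1 * N$3$2"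
    "N$1$1 * N$2$2 = N$1$2 * N$2$1"
    using True unfolding adj3_def vec_eq_iff forall_3 by simp_all
  have minors: "\<forall>i j k l. N$i$j * N$k$l = N$i$l * N$k$j"
    unfolding forall_3
    by (intro conjI; (simp only: mult.commute refl; fail | metis eqs mult.commute))
  show ?thesis
  proof (cases "N = 0")
    case True
    show ?thesis
      by (rule that[of "conic_pt (vector [1,0])"])
         (simp_all add: True cdot_conic_conic conic_eq_0_iff vec_eq_iff[of _ "0 :: complex^2"] forall_2)
  next
    case False
    then obtain k l where kl: "N$k$l \<noteq> 0" by (auto simp: vec_eq_iff)
    obtain p where p: "p \<noteq> 0" "cdot (conic_pt p) (N$k) = 0"
      using conic_orthogonal_exists by metis
    have "(N *v conic_pt p) $ i = 0" for i
    proof -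
      have "N$k$l * (N *v conic_pt p) $ i = N$i$l * cdot (conic_pt p) (N$k)"
        unfolding matrix_vector_mult_def sum_3 cdot_def vec_lambda_beta
        using minors[rule_format, of i 1 k l] minors[rule_format, of i 2 k l] minors[rule_format, of i 3 k l]
        by algebra
      then show ?thesis using kl p by simp
    qed
    then show ?thesis
      using p by (intro that[of "conic_pt p"]) (simp_all add: conic_eq_0_iff vec_eq_iff[of "N *v conic_pt p"] cdot_conic_conic)
  qed
qed

lemma complex_cubic_roots:
  fixes e1 e2 e3 :: complex
  obtains r1 r2 r3 where "e1 = r1 + r2 + r3" "e2 = r1 * r2 + r1 * r3 + r2 * r3" "e3 = r1 * r2 * r3"
proof -
  have "\<not> constant (poly [:- e3, e2, - e1, 1:])"
    by (simp add: constant_degree)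
  then obtain r where r: "- e3 + r * (e2 + r * (- e1 + r)) = 0"
    using fundamental_theorem_of_algebra by fastforce
  \<comment> \<open>Division of the cubic by t - r leaves the quotient t^2 - b t + c, whose
    discriminant is the square of s.\<close>
  define b c s where "b = e1 - r" and "c = e2 - r * b" and "s = csqrt (b\<^sup>2 - 4 * c)"
  have s: "s\<^sup>2 = b\<^sup>2 - 4 * c" by (simp add: s_def)
  have bc: "(b + s) / 2 * ((b - s) / 2) = c"
    using s by (simp add: field_simps power2_eq_square)
  show ?thesis
  proof (rule that[of r "(b + s) / 2" "(b - s) / 2"])
    show "e1 = r + (b + s) / 2 + (b - s) / 2" by (simp add: b_def field_simps)
    show "e2 = r * ((b + s) / 2) + r * ((b - s) / 2) + (b + s) / 2 * ((b - s) / 2)"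
      unfolding bc by (simp add: c_def field_simps)
    show "e3 = r * ((b + s) / 2) * ((b - s) / 2)"
      unfolding mult.assoc bc using r by (simp add: c_def b_def algebra_simps)
  qed
qed

lemma distinct_eigenvalues_if_no_isotropic_eigenvector:
  assumes sym: "transpose S = S"
    and no: "\<And>n r. cdot n n = 0 \<Longrightarrow> S *v n = r *s n \<Longrightarrow> n = 0"
  obtains r1 r2 r3 where "r1 \<noteq> r2" "r1 \<noteq> r3" "r2 \<noteq> r3"
    "det (S - mat r1) = 0" "det (S - mat r2) = 0" "det (S - mat r3) = 0"
proof -
  obtain r1 r2 r3 where e: "trace S = r1 + r2 + r3" "trace (adj3 S) = r1 * r2 + r1 * r3 + r2 * r3"
     "det S = r1 * r2 * r3" using complex_cubic_roots .
  have d: "det (S - mat x) = (r1 - x) * (r2 - x) * (r3 - x)" for x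
    by (simp add: det_shift e algebra_simps power2_eq_square power3_eq_cube)
  have t: "trace (adj3 (S - mat x)) = (r1 - x) * (r2 - x) + (r1 - x) * (r3 - x) + (r2 - x) * (r3 - x)" for x
    by (simp add: trace_adj3_shift e algebra_simps power2_eq_square)
  have *: "trace (adj3 (S - mat x)) \<noteq> 0" if det: "det (S - mat x) = 0" for x
  proof
    assume "trace (adj3 (S - mat x)) = 0"
    moreover have "transpose (S - mat x) = S - mat x"
      using sym by (simp add: vec_eq_iff transpose_def mat_def)
    ultimately obtain n where n: "n \<noteq> 0" "(S - mat x) *v n = 0" "cdot n n = 0"
      using isotropic_kernel_if_double_root[OF _ det] by blast
    then have "S *v n = x *s n"
      by (simp add: mat3_simps algebra_simps)
    then show False using no n by blast
  qed
  \<comment> \<open>At a root the trace of the adjugate is the product of the differences to the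
    other two roots, so r1 and r2 together separate all three.\<close>
  show ?thesis
    using *[of r1] *[of r2] by (intro that[of r1 r2 r3]) (auto simp: d t)
qed

section \<open>Orthonormal eigenbases and singular values\<close>

definition cols3 :: "complex^3 \<Rightarrow> complex^3 \<Rightarrow> complex^3 \<Rightarrow> complex^3^3" where
  "cols3 x y z = transpose (vector [x, y, z])"

lemma mult_cols3: "A ** cols3 x y z = cols3 (A *v x) (A *v y) (A *v z)"
  by (simp add: cols3_def mat3_simps)

lemma cols3_mult_diag3: "cols3 x y z ** diag3 (vector [a, b, c]) = cols3 (a *s x) (b *s y) (c *s z)"
  by (simp add: cols3_def diag3_def mat3_simps)

lemma mult_diag3_entry: "(A ** diag3 d) $ i $ j = A $ i $ j * d $ j"
  and diag3_mult_entry: "(diag3 d ** A) $ i $ j = d $ i * A $ i $ j"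
  by (simp_all add: diag3_def matrix_matrix_mult_def if_distrib[of "\<lambda>x. x * _"] if_distrib[of "\<lambda>x. _ * x"] cong: if_cong)

lemma orthonormal_cols3:
  assumes "cdot x x = 1" "cdot y y = 1" "cdot z z = 1" "cdot x y = 0" "cdot x z = 0" "cdot y z = 0"
  shows "transpose (cols3 x y z) ** cols3 x y z = mat 1"
proof -
  have entry: "(transpose A ** A) $ i $ j = cdot (column i A) (column j A)" for A i j
    by (simp add: column_def cdot_def matrix_matrix_mult_def transpose_def sum_3)
  have "column 1 (cols3 x y z) = x" "column 2 (cols3 x y z) = y" "column 3 (cols3 x y z) = z"
    by (simp_all add: cols3_def column_def transpose_def vec_eq_iff)
  then show ?thesis
    unfolding vec_eq_iff[of _ "mat 1 :: complex^3^3"] vec_eq_iff[of _ "mat 1 $ _"] forall_3 entry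
    by (simp add: assms cdot_commute[of y x] cdot_commute[of z x] cdot_commute[of z y] mat_def)
qed

lemma det_diag3: "det (diag3 (vector [a, b, c])) = a * b * c"
  by (simp add: det_3 diag3_def)

lemma simple_root_unit_kernel:
  assumes sym: "transpose N = N" and det: "det N = 0" and tr: "trace (adj3 N) \<noteq> 0"
  obtains n where "N *v n = 0" "cdot n n = 1"
proof -
  \<comment> \<open>Here \<open>adj3 N\<close> has rank one, and by the second part of \<open>adj3_column\<close> some column is a non-isotropic kernel vector.\<close>
  obtain j where j: "adj3 N $ j $ j \<noteq> 0"
    using tr by (metis add.right_neutral trace_3)
  define k where "k = column j (adj3 N)"
  define s where "s = csqrt (cdot k k)"
  have k: "N *v k = 0" "cdot k k \<noteq> 0"
    using adj3_column[OF sym det, of j] j tr by (simp_all add: k_def)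
  have s: "s * s = cdot k k" by (simp add: s_def flip: power2_eq_square)
  show ?thesis
  proof (rule that[of "inverse s *s k"])
    show "N *v (inverse s *s k) = 0" unfolding vec.scale k by simp
    show "cdot (inverse s *s k) (inverse s *s k) = 1" using k by (simp add: field_simps flip: s)
  qed
qed

text \<open>Simple eigenvalues have eigenvectors that can be normalised, and symmetry makes
  eigenvectors for different eigenvalues orthogonal. The sign of the third one is chosen to get
  determinant 1.\<close>

lemma symmetric_diagonalisation:
  assumes sym: "transpose S = S" and ne: "r1 \<noteq> r2" "r1 \<noteq> r3" "r2 \<noteq> r3"
    and r: "det (S - mat r1) = 0" "det (S - mat r2) = 0" "det (S - mat r3) = 0"
  obtains T where "T \<in> SO3" "S ** T = T ** diag3 (vector [r1, r2, r3])"
proof -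
  \<comment> \<open>The divided difference of the characteristic polynomial at r1 and x; dividing
    out the known roots one at a time recovers the Vieta relations.\<close>
  define q where "q x = r1\<^sup>2 + r1 * x + x\<^sup>2 - trace S * (r1 + x) + trace (adj3 S)" for x
  have "(r1 - x) * q x = det (S - mat x) - det (S - mat r1)" for x
    by (simp add: q_def det_shift algebra_simps power2_eq_square power3_eq_cube)
  from this[of r2] this[of r3] have q: "q r2 = 0" "q r3 = 0" using ne r by auto
  have "(r2 - r3) * (r1 + r2 + r3 - trace S) = q r2 - q r3"
    by (simp add: q_def algebra_simps power2_eq_square)
  then have e1: "trace S = r1 + r2 + r3" using ne q by auto
  have e2: "trace (adj3 S) = r1 * r2 + r1 * r3 + r2 * r3"
    using q(1) by (simp add: q_def e1 algebra_simps power2_eq_square)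
  have tr: "trace (adj3 (S - mat r1)) \<noteq> 0" "trace (adj3 (S - mat r2)) \<noteq> 0" "trace (adj3 (S - mat r3)) \<noteq> 0"
  proof -
    have "trace (adj3 (S - mat r1)) = (r1 - r2) * (r1 - r3)"
      "trace (adj3 (S - mat r2)) = (r2 - r1) * (r2 - r3)"
      "trace (adj3 (S - mat r3)) = (r3 - r1) * (r3 - r2)"
      unfolding trace_adj3_shift e1 e2 by (simp_all add: algebra_simps power2_eq_square)
    then show "trace (adj3 (S - mat r1)) \<noteq> 0" "trace (adj3 (S - mat r2)) \<noteq> 0" "trace (adj3 (S - mat r3)) \<noteq> 0"
      using ne by simp_all
  qed
  have sym': "transpose (S - mat x) = S - mat x" for x
    using sym by (simp add: vec_eq_iff transpose_def mat_def)
  have eig: "\<exists>n. S *v n = x *s n \<and> cdot n n = 1"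
    if N: "det (S - mat x) = 0" "trace (adj3 (S - mat x)) \<noteq> 0" for x
  proof -
    obtain n where "(S - mat x) *v n = 0" "cdot n n = 1"
      using simple_root_unit_kernel[OF sym' N] .
    then show ?thesis by (intro exI[of _ n]) (simp add: mat3_simps algebra_simps)
  qed
  obtain x where x: "S *v x = r1 *s x" "cdot x x = 1" using eig[OF r(1) tr(1)] by blast
  obtain y where y: "S *v y = r2 *s y" "cdot y y = 1" using eig[OF r(2) tr(2)] by blast
  obtain z0 where z0: "S *v z0 = r3 *s z0" "cdot z0 z0 = 1" using eig[OF r(3) tr(3)] by blast
  have orth: "cdot u v = 0" if "S *v u = a *s u" "S *v v = b *s v" "a \<noteq> b" for u v a b
    using cdot_matrix_left[of S u v] unfolding sym that(1,2) using that(3) by simp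
  have o: "cdot x y = 0" "cdot x z0 = 0" "cdot y z0 = 0"
    using orth x y z0 ne by blast+
  have "det (transpose (cols3 x y z0) ** cols3 x y z0) = 1"
    unfolding orthonormal_cols3[OF x(2) y(2) z0(2) o] by simp
  then have "(det (cols3 x y z0))\<^sup>2 = 1"
    by (simp add: det_mul power2_eq_square)
  then have "det (cols3 x y z0) = 1 \<or> det (cols3 x y z0) = -1" by (simp add: power2_eq_1_iff)
  then obtain z where z: "S *v z = r3 *s z" "cdot z z = 1" "cdot x z = 0" "cdot y z = 0"
    and d: "det (cols3 x y z) = 1"
  proof
    assume "det (cols3 x y z0) = 1"
    then show ?thesis by (intro that[of z0] z0 o)
  next
    assume "det (cols3 x y z0) = -1"
    moreover have "det (cols3 x y (- z0)) = - det (cols3 x y z0)"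
      by (simp add: cols3_def det_3 transpose_def algebra_simps)
    moreover have "S *v (- z0) = - (S *v z0)"
      by (simp add: mat3_simps)
    moreover have "cdot u (- v) = - cdot u v" "cdot (- v) u = - cdot v u" for u v
      by (simp_all add: cdot_def)
    ultimately show ?thesis using z0 o by (intro that[of "- z0"]) simp_all
  qed
  show ?thesis
  proof (rule that[of "cols3 x y z"])
    show "cols3 x y z \<in> SO3"
      using orthonormal_cols3[OF x(2) y(2) z(2) o(1) z(3,4)] d by (simp add: SO3_def)
    show "S ** cols3 x y z = cols3 x y z ** diag3 (vector [r1, r2, r3])"
      unfolding mult_cols3 cols3_mult_diag3 x(1) y(1) z(1) ..
  qed
qed

lemma finite_SO3_centraliser:
  assumes T: "T \<in> SO3" and ne: "r1 \<noteq> r2" "r1 \<noteq> r3" "r2 \<noteq> r3"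
    and S: "S ** T = T ** diag3 (vector [r1, r2, r3])"
  shows "finite {R \<in> SO3. transpose R ** S ** R = S}"
proof -
  let ?D = "diag3 (vector [r1, r2, r3])"
  have "{R \<in> SO3. transpose R ** S ** R = S} \<subseteq>
    (\<lambda>(a,b,c). T ** diag3 (vector [a,b,c]) ** transpose T) ` ({1,-1} \<times> {1,-1} \<times> {1,-1})"
  proof clarify
    fix R assume R: "R \<in> SO3" "transpose R ** S ** R = S"
    define B where "B = transpose T ** R ** T"
    have TB: "T ** B ** transpose T = R"
    proof -
      have "T ** B ** transpose T = (T ** transpose T) ** R ** (T ** transpose T)"
        unfolding B_def matrix_mul_assoc ..
      then show ?thesis unfolding SO3_D(2)[OF T] by simp
    qed
    have "B \<in> SO3"
      unfolding B_def by (intro SO3_mult SO3_transpose T R)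
    have SR: "S ** R = R ** S"
    proof -
      have "R ** (transpose R ** S ** R) = (R ** transpose R) ** S ** R"
        unfolding matrix_mul_assoc ..
      then show ?thesis unfolding SO3_D(2)[OF R(1)] R(2) by simp
    qed
    have D: "?D = transpose T ** S ** T"
      unfolding matrix_mul_assoc[symmetric] S
      unfolding matrix_mul_assoc SO3_D(1)[OF T] by simp
    have "?D ** B = transpose T ** S ** (T ** transpose T) ** R ** T"
      unfolding D B_def matrix_mul_assoc ..
    also have "\<dots> = transpose T ** (S ** R) ** T"
      unfolding SO3_D(2)[OF T] by (simp add: matrix_mul_assoc)
    also have "\<dots> = transpose T ** R ** (T ** transpose T) ** S ** T"
      unfolding SO3_D(2)[OF T] SR by (simp add: matrix_mul_assoc)
    also have "\<dots> = B ** ?D"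
      unfolding D B_def matrix_mul_assoc ..
    finally have DB: "?D ** B = B ** ?D" .
    \<comment> \<open>Comparing entries of the commutation relation kills every off-diagonal entry
      of B, since the eigenvalues are distinct.\<close>
    have "(vector [r1, r2, r3] $ i - vector [r1, r2, r3] $ j) * B $ i $ j = 0" for i j
      using arg_cong[OF DB, of "\<lambda>A. A $ i $ j"]
      unfolding mult_diag3_entry diag3_mult_entry by (simp add: algebra_simps)
    from this[of 1 2] this[of 1 3] this[of 2 1] this[of 2 3] this[of 3 1] this[of 3 2]
    have off: "B$1$2 = 0" "B$1$3 = 0" "B$2$1 = 0" "B$2$3 = 0" "B$3$1 = 0" "B$3$2 = 0"
      using ne by simp_all
    then have B: "B = diag3 (vector [B$1$1, B$2$2, B$3$3])"
      by (simp add: diag3_def mat3_simps)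
    have "(B$1$1)\<^sup>2 = 1" "(B$2$2)\<^sup>2 = 1" "(B$3$3)\<^sup>2 = 1"
      using SO3_D(1)[OF \<open>B \<in> SO3\<close>] off by (simp_all add: mat3_simps power2_eq_square)
    then have "(B$1$1, B$2$2, B$3$3) \<in> {1,-1} \<times> {1,-1} \<times> {1,-1}"
      by (auto simp: power2_eq_1_iff)
    moreover have "R = T ** diag3 (vector [B$1$1, B$2$2, B$3$3]) ** transpose T"
      unfolding B[symmetric] TB ..
    ultimately show "R \<in> (\<lambda>(a,b,c). T ** diag3 (vector [a,b,c]) ** transpose T) ` ({1,-1} \<times> {1,-1} \<times> {1,-1})"
      by (intro image_eqI[of _ _ "(B$1$1, B$2$2, B$3$3)"]) simp_all
  qed
  then show ?thesis by (rule finite_subset) simp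
qed

text \<open>Once Q diagonalises \<open>transpose M ** M\<close>, the columns of
  \<open>M ** Q\<close> are mutually orthogonal; the first two are normalised by d1 and d2. The
  value r3 may be 0, so d3 is prescribed through the determinant. The diagonal factor thus depends
  only on data shared by all matrices with these eigenvalues and this determinant.\<close>

lemma singular_value_decomposition:
  assumes ne: "r1 \<noteq> r2" "r1 \<noteq> r3" "r2 \<noteq> r3"
    and r: "det (transpose M ** M - mat r1) = 0" "det (transpose M ** M - mat r2) = 0"
      "det (transpose M ** M - mat r3) = 0"
    and d: "d1\<^sup>2 = r1" "d2\<^sup>2 = r2" "d1 \<noteq> 0" "d2 \<noteq> 0" "det M = d1 * d2 * d3"
  obtains P Q where "P \<in> SO3" "Q \<in> SO3" "M = P ** diag3 (vector [d1, d2, d3]) ** transpose Q"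
    "transpose M ** M ** Q = Q ** diag3 (vector [r1, r2, r3])" "d3\<^sup>2 = r3"
proof -
  let ?D = "diag3 (vector [d1, d2, d3])"
  have "transpose (transpose M ** M) = transpose M ** M"
    by (simp add: matrix_transpose_mul)
  then obtain Q where Q: "Q \<in> SO3" and MQ: "transpose M ** M ** Q = Q ** diag3 (vector [r1, r2, r3])"
    using symmetric_diagonalisation[OF _ ne r] by blast
  define N where "N = M ** Q"
  have "transpose N ** N = transpose Q ** (transpose M ** M ** Q)"
    unfolding N_def matrix_transpose_mul matrix_mul_assoc ..
  also have "\<dots> = (transpose Q ** Q) ** diag3 (vector [r1, r2, r3])"
    unfolding MQ matrix_mul_assoc ..
  finally have NN: "transpose N ** N = diag3 (vector [r1, r2, r3])"
    unfolding SO3_D(1)[OF Q] by simp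
  have detN: "det N = d1 * d2 * d3" by (simp add: N_def det_mul d SO3_D(3)[OF Q])
  define c where "c j = column j N" for j
  have cc: "cdot (c i) (c j) = (transpose N ** N) $ i $ j" for i j
    by (simp add: c_def column_def cdot_def mat3_simps)
  have c: "cdot (c 1) (c 1) = d1\<^sup>2" "cdot (c 2) (c 2) = d2\<^sup>2" "cdot (c 3) (c 3) = r3"
      "cdot (c 1) (c 2) = 0" "cdot (c 1) (c 3) = 0" "cdot (c 2) (c 3) = 0"
    unfolding cc NN d by (simp_all add: diag3_def)
  \<comment> \<open>The cross product completes x, y to an orthonormal frame of determinant 1 even
    if the third column of N vanishes.\<close>
  define x y z where "x = inverse d1 *s c 1" and "y = inverse d2 *s c 2" and "z = ccross x y"
  have c12: "c 1 = d1 *s x" "c 2 = d2 *s y" using d by (simp_all add: x_def y_def)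
  have xy: "cdot x x = 1" "cdot y y = 1" "cdot x y = 0" and xyc: "cdot x (c 3) = 0" "cdot y (c 3) = 0"
    using c(1,2,4-6) d(3,4) by (simp_all add: x_def y_def power2_eq_square field_simps)
  have xyz: "cdot x z = 0" "cdot y z = 0"
    by (simp_all add: z_def cdot_def ccross_def algebra_simps)
  have "cdot z z = cdot x x * cdot y y - (cdot x y)\<^sup>2"
    by (simp add: z_def cdot_def ccross_def algebra_simps power2_eq_square)
  then have zz: "cdot z z = 1" by (simp add: xy)
  define P where "P = cols3 x y z"
  have "det P = cdot z z"
    by (simp add: P_def cols3_def det_3 transpose_def cdot_def z_def ccross_def algebra_simps)
  then have P: "P \<in> SO3"
    using orthonormal_cols3[OF xy(1,2) zz xy(3) xyz] by (simp add: SO3_def P_def zz)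
  have "transpose P ** N = diag3 (vector [d1, d2, cdot z (c 3)])"
  proof -
    have entry: "(transpose P ** N) $ i $ j = cdot (column i P) (c j)" for i j
      by (simp add: c_def column_def cdot_def mat3_simps)
    have col: "column 1 P = x" "column 2 P = y" "column 3 P = z"
      by (simp_all add: P_def cols3_def column_def transpose_def vec_eq_iff)
    show ?thesis
      unfolding vec_eq_iff forall_3 entry col c12
      using xyc xyz xy zz
      by (simp add: diag3_def cdot_commute[of y x] cdot_commute[of z x] cdot_commute[of z y])
  qed
  \<comment> \<open>Comparing determinants identifies the last diagonal entry with d3, because d1
    and d2 are nonzero.\<close>
  moreover have "det (transpose P ** N) = d1 * d2 * d3"
    using detN P by (simp add: det_mul SO3_D(3))
  ultimately have PN: "transpose P ** N = ?D"
    using d by (simp add: det_diag3)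
  have N: "N = P ** ?D"
    unfolding PN[symmetric] matrix_mul_assoc SO3_D(2)[OF P] by simp
  have M: "M = P ** ?D ** transpose Q"
  proof -
    have "N ** transpose Q = M ** (Q ** transpose Q)" unfolding N_def matrix_mul_assoc ..
    then show ?thesis unfolding SO3_D(2)[OF Q] N by simp
  qed
  have "transpose N ** N = transpose ?D ** (transpose P ** P) ** ?D"
    unfolding N matrix_transpose_mul matrix_mul_assoc ..
  then have "diag3 (vector [r1, r2, r3]) = transpose ?D ** ?D"
    unfolding NN SO3_D(1)[OF P] by simp
  then have "d3\<^sup>2 = r3" by (simp add: diag3_def mat3_simps power2_eq_square)
  then show ?thesis using that P Q M MQ by blast
qed

subsection \<open>Biconic forms as matrices\<close>

lemma sum_atMost_2: "(\<Sum>i\<le>2. f i) = f 0 + f 1 + f (2::nat)"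
  by (simp add: numeral_2_eq_2)

text \<open>\<open>mono_covec i\<close> is the linear form on \<open>\<complex>\<^sup>3\<close> that restricts to \<open>X\<^sup>i U\<^sup>2\<^sup>-\<^sup>i\<close> on \<^const>\<open>conic_pt\<close>.\<close>

definition mono_covec :: "nat \<Rightarrow> complex^3" where
  "mono_covec i = (if i = 0 then vector [- 1 / 2, - \<i> / 2, 0]
     else if i = 1 then vector [0, 0, 1 / 2] else vector [1 / 2, - \<i> / 2, 0])"

definition mat22 :: "coeffs \<Rightarrow> complex^3^3" where
  "mat22 a = (\<chi> k l. \<Sum>i\<le>2. \<Sum>j\<le>2. a i j * mono_covec i $ k * mono_covec j $ l)"

lemma cdot_mat22:
  "cdot x (mat22 a *v y) = (\<Sum>i\<le>2. \<Sum>j\<le>2. a i j * cdot (mono_covec i) x * cdot (mono_covec j) y)"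
proof -
  have "cdot x ((\<chi> k l. c * e $ k * f $ l) *v y) = c * cdot e x * cdot f y" for c e f
    by (simp add: cdot_def matrix_vector_mult_def sum_3 algebra_simps)
  moreover have "cdot x ((\<chi> k l. u k l + v k l) *v y) = cdot x ((\<chi> k l. u k l) *v y) + cdot x ((\<chi> k l. v k l) *v y)" for u v
    by (simp add: cdot_def matrix_vector_mult_def sum_3 algebra_simps)
  ultimately show ?thesis
    unfolding mat22_def sum_atMost_2 by simp
qed

lemma mono_covec_conic:
  assumes "i \<in> {..2}"
  shows "cdot (mono_covec i) (conic_pt p) = (p$1)^i * (p$2)^(2-i)"
    and "cdot (mono_covec i) (conicX p) = of_nat i * (p$1)^(i-1) * (p$2)^(2-i)"
    and "cdot (mono_covec i) (conicU p) = of_nat (2-i) * (p$1)^i * (p$2)^(1-i)"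
proof -
  have "i = 0 \<or> i = 1 \<or> i = 2" using assms by auto
  then show "cdot (mono_covec i) (conic_pt p) = (p$1)^i * (p$2)^(2-i)"
    "cdot (mono_covec i) (conicX p) = of_nat i * (p$1)^(i-1) * (p$2)^(2-i)"
    "cdot (mono_covec i) (conicU p) = of_nat (2-i) * (p$1)^i * (p$2)^(1-i)"
    by (auto simp: cdot_def mono_covec_def conic_pt_def conicX_def conicU_def field_simps)
qed

text \<open>Each partial derivative acts on just one of the two conic points, so all five functions
  are values of one bilinear form.\<close>

lemma form22_mat22: "form22 a p q = cdot (conic_pt p) (mat22 a *v conic_pt q)"
  and dX22_mat22: "dX22 a p q = cdot (conicX p) (mat22 a *v conic_pt q)"
  and dU22_mat22: "dU22 a p q = cdot (conicU p) (mat22 a *v conic_pt q)"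
  and dY22_mat22: "dY22 a p q = cdot (conic_pt p) (mat22 a *v conicX q)"
  and dV22_mat22: "dV22 a p q = cdot (conic_pt p) (mat22 a *v conicU q)"
  unfolding form22_def dX22_def dU22_def dY22_def dV22_def cdot_mat22
  by (intro sum.cong refl; simp only: mono_covec_conic mult.assoc mult.left_commute)+

lemma mat22_surj:
  obtains b where "b \<in> bideg22_space" "mat22 b = N"
proof -
  \<comment> \<open>The coefficient vectors of the monomials in \<open>conic_pt\<close>, which form
    the basis dual to \<open>mono_covec\<close>.\<close>
  define c :: "nat \<Rightarrow> complex^3" where
    "c i = (if i = 0 then vector [-1, \<i>, 0] else if i = 1 then vector [0, 0, 2] else vector [1, \<i>, 0])" for i
  define b where "b i j = (if i \<le> 2 \<and> j \<le> 2 then cdot (c i) (N *v c j) else 0)" for i j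
  have conic: "conic_pt p = (p$2)\<^sup>2 *s c 0 + (p$1 * p$2) *s c 1 + (p$1)\<^sup>2 *s c 2" for p
    by (simp add: c_def conic_pt_def vec_eq_iff forall_3 algebra_simps)
  have add: "cdot (x + y) z = cdot x z + cdot y z" "cdot z (x + y) = cdot z x + cdot z y" for x y z
    by (simp_all add: cdot_def algebra_simps)
  have "form22 b p q = cdot (conic_pt p) (N *v conic_pt q)" for p q
    unfolding form22_def sum_atMost_2 conic vec.add vec.scale add cdot_scale
    by (simp add: b_def algebra_simps power2_eq_square)
  then have "mat22 b = N"
    by (intro matrix_eq_on_conic) (simp flip: form22_mat22)
  moreover have "b \<in> bideg22_space" by (auto simp: b_def bideg22_space_def)
  ultimately show ?thesis using that by blast
qed

lemma form22_action:
  "form22 a (g *v p) (h *v q) = cdot (conic_pt p) ((transpose (spin g) ** mat22 a ** spin h) *v conic_pt q)"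
  by (simp only: form22_mat22 conic_spin cdot_matrix_left matrix_vector_mul_assoc matrix_mul_assoc)

lemma mat22_eq_action_iff:
  "mat22 b = transpose (spin g) ** mat22 a ** spin h \<longleftrightarrow>
    (\<forall>p q. form22 b p q = form22 a (g *v p) (h *v q))"
  unfolding form22_action form22_mat22[of b] by (rule iffI, simp, rule matrix_eq_on_conic) blast

text \<open>Surjectivity of \<open>spin\<close> lets every pair of rotations be lifted to
  \<open>SL2\<close>.\<close>

lemma orbit22_iff:
  "b \<in> orbit22 a \<longleftrightarrow> b \<in> bideg22_space \<and>
    (\<exists>S\<in>SO3. \<exists>T\<in>SO3. mat22 b = transpose S ** mat22 a ** T)"
proof -
  have SO3: "SO3 = spin ` SL2"
  proof
    show "SO3 \<subseteq> spin ` SL2" by (metis imageI spin_surj subsetI)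
  qed (use spin_SO3 in blast)
  then show ?thesis
    unfolding orbit22_def mem_Collect_eq mat22_eq_action_iff[symmetric] SO3 by simp
qed

lemma stabilizer22_iff:
  "(g, h) \<in> stabilizer22 a \<longleftrightarrow> g \<in> SL2 \<and> h \<in> SL2 \<and>
    transpose (spin g) ** mat22 a ** spin h = mat22 a"
  unfolding stabilizer22_def mem_Collect_eq case_prod_conv
    eq_commute[of _ "mat22 a"] mat22_eq_action_iff
  by (simp only: eq_commute[of "form22 a (g *v _) (h *v _)"])

subsection \<open>Smooth curves are stable\<close>

text \<open>Obtained by differentiating the isotropy relation of \<open>conic_pt p\<close>.\<close>

lemma conicX_conicU_tangent:
  "cdot (conicX p) (conic_pt p) = 0" "cdot (conicU p) (conic_pt p) = 0"
  by (simp_all add: cdot_def conicX_def conicU_def conic_pt_def algebra_simps power2_eq_square)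

lemma conic_euler: "2 *s conic_pt p = (p$1) *s conicX p + (p$2) *s conicU p"
  by (simp add: conicX_def conicU_def conic_pt_def algebra_simps power2_eq_square vec_eq_iff forall_3)

text \<open>Write M for \<open>mat22 a\<close> and n as the conic point of q. If Mn is nonzero, it
  is isotropic because \<open>cdot n n = 0\<close>, so it is the conic point of some p. The
  derivatives in p vanish by tangency at p, and those in q because \<open>transpose M\<close> maps
  Mn to a multiple of n, so tangency at q applies.\<close>

lemma singular_if_isotropic_eigenvector:
  assumes n: "n \<noteq> 0" "cdot n n = 0" and S: "transpose (mat22 a) ** mat22 a *v n = r *s n"
  shows "\<not> smooth_biconic a"
proof -
  let ?M = "mat22 a"
  obtain q where q: "n = conic_pt q" using isotropic_conic[OF n(2)] .
  have q0: "q \<noteq> 0" using n q conic_eq_0_iff by blast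
  have left: "cdot (?M *v x) (?M *v y) = cdot x (transpose ?M ** ?M *v y)" for x y
    by (simp only: cdot_matrix_left matrix_vector_mul_assoc)
  have "\<exists>p. singular_point22 a p q"
  proof (cases "?M *v n = 0")
    case True
    \<comment> \<open>By Euler's relation \<open>M\<close> maps the tangent plane at \<open>n\<close> to a line, so a single orthogonality
      condition on \<open>conic_pt p\<close> suffices.\<close>
    have lin: "(q$1) *s (?M *v conicX q) + (q$2) *s (?M *v conicU q) = 0"
      unfolding vec.scale[symmetric] vec.add[symmetric] conic_euler[symmetric]
      unfolding vec.scale q[symmetric] True by simp
    have "\<exists>y. \<forall>z. cdot z y = 0 \<longrightarrow> cdot z (?M *v conicX q) = 0 \<and> cdot z (?M *v conicU q) = 0"
    proof -
      have sum: "q$1 * cdot z (?M *v conicX q) + q$2 * cdot z (?M *v conicU q) = 0" for z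
        using arg_cong[OF lin, of "cdot z"] by (simp add: cdot_def algebra_simps)
      have "q$1 \<noteq> 0 \<or> q$2 \<noteq> 0" using q0 by (simp add: vec_eq_iff forall_2)
      then show ?thesis
      proof
        assume "q$1 \<noteq> 0"
        then have "cdot z (?M *v conicX q) = 0" if "cdot z (?M *v conicU q) = 0" for z
          using sum[of z] that by simp
        then show ?thesis by blast
      next
        assume "q$2 \<noteq> 0"
        then have "cdot z (?M *v conicU q) = 0" if "cdot z (?M *v conicX q) = 0" for z
          using sum[of z] that by simp
        then show ?thesis by blast
      qed
    qed
    then obtain y where y: "\<And>z. cdot z y = 0 \<Longrightarrow> cdot z (?M *v conicX q) = 0 \<and> cdot z (?M *v conicU q) = 0"
      by blast
    obtain p where p: "p \<noteq> 0" "cdot (conic_pt p) y = 0" by (rule conic_orthogonal_exists)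
    have "singular_point22 a p q"
      unfolding singular_point22_def form22_mat22 dX22_mat22 dU22_mat22 dY22_mat22 dV22_mat22
      using p y q0 True by (simp add: q)
    then show ?thesis ..
  next
    case False
    have "cdot (?M *v n) (?M *v n) = 0" unfolding left S by (simp add: n)
    then obtain p where p: "?M *v n = conic_pt p" using isotropic_conic by metis
    have p0: "p \<noteq> 0" using False p conic_eq_0_iff by metis
    have "cdot (conic_pt p) (?M *v x) = r * cdot x n" for x
    proof -
      have "cdot (?M *v n) (?M *v x) = cdot (?M *v x) (?M *v n)" by (rule cdot_commute)
      also have "\<dots> = r * cdot x n" unfolding left S by simp
      finally show ?thesis by (simp only: p)
    qed
    then have "singular_point22 a p q"
      unfolding singular_point22_def form22_mat22 dX22_mat22 dU22_mat22 dY22_mat22 dV22_mat22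
      using p p0 q0 by (simp add: q conicX_conicU_tangent cdot_conic_conic)
    then show ?thesis ..
  qed
  then show ?thesis by (auto simp: smooth_biconic_def)
qed

section \<open>Polynomial equations for the orbit\<close>

lemma poly_fun_diff: "p \<in> poly_fun \<Longrightarrow> q \<in> poly_fun \<Longrightarrow> (\<lambda>a. p a - q a) \<in> poly_fun"
  using poly_fun.add[OF _ poly_fun.mult[OF poly_fun.const[of "-1"]], of p q] by simp

lemma poly_fun_mat22: "(\<lambda>a. mat22 a $ k $ l) \<in> poly_fun"
  unfolding mat22_def sum_atMost_2 vec_lambda_beta
  by (intro poly_fun.intros)

lemma poly_fun_det:
  assumes "\<And>k l. (\<lambda>a. F a $ k $ l) \<in> poly_fun"
  shows "(\<lambda>a. det (F a :: complex^3^3)) \<in> poly_fun"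
  unfolding det_3 by (intro poly_fun_diff poly_fun.add poly_fun.mult assms)

lemma poly_fun_char_mat22: "(\<lambda>a. det (transpose (mat22 a) ** mat22 a - mat r)) \<in> poly_fun"
proof (rule poly_fun_det)
  fix k l
  have "(\<lambda>a. (transpose (mat22 a) ** mat22 a - mat r) $ k $ l) =
    (\<lambda>a. mat22 a $ 1 $ k * mat22 a $ 1 $ l + mat22 a $ 2 $ k * mat22 a $ 2 $ l
       + mat22 a $ 3 $ k * mat22 a $ 3 $ l - (if k = l then r else 0))"
    by (simp add: matrix_matrix_mult_def transpose_def sum_3 mat_def)
  then show "(\<lambda>a. (transpose (mat22 a) ** mat22 a - mat r) $ k $ l) \<in> poly_fun"
    by (simp only:) (intro poly_fun_diff poly_fun.add poly_fun.mult poly_fun_mat22 poly_fun.const)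
qed

lemma mat_scalar_mult_commute: "A ** mat r = mat r ** (A :: complex^'n^'n)"
  by (simp add: vec_eq_iff matrix_matrix_mult_def mat_def mult.commute
      if_distrib[of "\<lambda>x. x * _"] if_distrib[of "\<lambda>x. _ * x"] cong: if_cong)

lemma matrix_diff_ldistrib: "A ** (B - C) = A ** B - A ** (C :: complex^'n^'m)"
  by (simp add: vec_eq_iff matrix_matrix_mult_def right_diff_distrib sum_subtractf)

lemma matrix_diff_rdistrib: "(A - B) ** C = A ** C - B ** (C :: complex^'n^'m)"
  by (simp add: vec_eq_iff matrix_matrix_mult_def left_diff_distrib sum_subtractf)

lemma smooth_imp_stable:
  assumes a: "a \<in> bideg22_space" and smooth: "smooth_biconic a"
  shows "git_stable22 a"
proof -
  let ?S = "\<lambda>b. transpose (mat22 b) ** mat22 b"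
  have "transpose (?S a) = ?S a" by (simp add: matrix_transpose_mul)
  then obtain s1 s2 s3 where s: "s1 \<noteq> s2" "s1 \<noteq> s3" "s2 \<noteq> s3"
    "det (?S a - mat s1) = 0" "det (?S a - mat s2) = 0" "det (?S a - mat s3) = 0"
    using distinct_eigenvalues_if_no_isotropic_eigenvector[of "?S a"]
      singular_if_isotropic_eigenvector[of _ a] smooth by blast
  \<comment> \<open>At most one of the distinct eigenvalues is zero; it is put last, since the
    decomposition divides by d1 and d2.\<close>
  obtain r1 r2 r3 where ne: "r1 \<noteq> r2" "r1 \<noteq> r3" "r2 \<noteq> r3" and nz: "r1 \<noteq> 0" "r2 \<noteq> 0"
    and r: "det (?S a - mat r1) = 0" "det (?S a - mat r2) = 0" "det (?S a - mat r3) = 0"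
  proof (cases "s1 = 0")
    case True
    then show ?thesis using s by (intro that[of s2 s3 s1]) auto
  next
    case False
    then show ?thesis using s that[of s1 s2 s3] that[of s1 s3 s2] by (cases "s2 = 0") auto
  qed
  define d1 d2 d3 where "d1 = csqrt r1" and "d2 = csqrt r2" and "d3 = det (mat22 a) / (d1 * d2)"
  have d: "d1\<^sup>2 = r1" "d2\<^sup>2 = r2" "d1 \<noteq> 0" "d2 \<noteq> 0" "det (mat22 a) = d1 * d2 * d3"
    using nz by (auto simp: d1_def d2_def d3_def)
  let ?D = "diag3 (vector [d1, d2, d3])"
  obtain P Q where P: "P \<in> SO3" and Q: "Q \<in> SO3" and M: "mat22 a = P ** ?D ** transpose Q"
    and SQ: "?S a ** Q = Q ** diag3 (vector [r1, r2, r3])" and d3: "d3\<^sup>2 = r3"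
    using singular_value_decomposition[OF ne r d] .
  \<comment> \<open>The eigenvalues fix the determinant of \<open>mat22 b\<close> only up to sign,
    hence the separate determinant equation.\<close>
  have "orbit22 a = {b \<in> bideg22_space. det (mat22 b) = det (mat22 a) \<and>
      (\<forall>r\<in>{r1,r2,r3}. det (?S b - mat r) = 0)}"
  proof (intro set_eqI iffI)
    fix b assume "b \<in> orbit22 a"
    then obtain T U where b: "b \<in> bideg22_space" and T: "T \<in> SO3" and U: "U \<in> SO3"
      and bM: "mat22 b = transpose T ** mat22 a ** U" unfolding orbit22_iff by blast
    have "det (mat22 b) = det (mat22 a)"
      unfolding bM det_mul det_transpose SO3_D(3)[OF T] SO3_D(3)[OF U] by simp
    moreover have "det (?S b - mat r) = det (?S a - mat r)" for r
    proof -
      have "?S b = transpose U ** transpose (mat22 a) ** (T ** transpose T) ** mat22 a ** U"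
        unfolding bM matrix_transpose_mul transpose_transpose matrix_mul_assoc ..
      also have "\<dots> = transpose U ** ?S a ** U"
        unfolding SO3_D(2)[OF T] by (simp add: matrix_mul_assoc)
      finally have Sb: "?S b = transpose U ** ?S a ** U" .
      have "mat r = transpose U ** mat r ** U"
      proof -
        have "transpose U ** mat r ** U = mat r ** (transpose U ** U)"
          unfolding mat_scalar_mult_commute matrix_mul_assoc ..
        then show ?thesis unfolding SO3_D(1)[OF U] by simp
      qed
      moreover have "transpose U ** ?S a ** U - transpose U ** mat r ** U = transpose U ** (?S a - mat r) ** U"
        by (simp add: matrix_diff_ldistrib matrix_diff_rdistrib)
      ultimately have "?S b - mat r = transpose U ** (?S a - mat r) ** U"
        unfolding Sb by metis
      then show ?thesis
        by (simp add: det_mul SO3_D(3)[OF U])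
    qed
    ultimately show "b \<in> {b \<in> bideg22_space. det (mat22 b) = det (mat22 a) \<and>
      (\<forall>r\<in>{r1,r2,r3}. det (?S b - mat r) = 0)}"
      using b r by simp
  next
    fix b assume b: "b \<in> {b \<in> bideg22_space. det (mat22 b) = det (mat22 a) \<and>
      (\<forall>r\<in>{r1,r2,r3}. det (?S b - mat r) = 0)}"
    then have rb: "det (?S b - mat r1) = 0" "det (?S b - mat r2) = 0" "det (?S b - mat r3) = 0"
      and db: "det (mat22 b) = d1 * d2 * d3" using d by auto
    obtain P' Q' where P': "P' \<in> SO3" and Q': "Q' \<in> SO3" and M': "mat22 b = P' ** ?D ** transpose Q'"
      using singular_value_decomposition[OF ne rb d(1-4) db] .
    \<comment> \<open>Both matrices share the diagonal factor, so the outer rotations alone carry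
      one to the other.\<close>
    have "transpose (P ** transpose P') ** mat22 a ** (Q ** transpose Q')
      = P' ** (transpose P ** P) ** ?D ** (transpose Q ** Q) ** transpose Q'"
      unfolding M matrix_transpose_mul transpose_transpose matrix_mul_assoc ..
    also have "\<dots> = mat22 b"
      unfolding SO3_D(1)[OF P] SO3_D(1)[OF Q] M' by simp
    finally show "b \<in> orbit22 a"
      unfolding orbit22_iff using b SO3_mult SO3_transpose P Q P' Q'
      by (metis (no_types, lifting) mem_Collect_eq)
  qed
  also have "\<dots> = {b \<in> bideg22_space. \<forall>f \<in> insert (\<lambda>b. det (mat22 b) - det (mat22 a))
      ((\<lambda>r b. det (?S b - mat r)) ` {r1, r2, r3}). f b = 0}"
    by auto
  finally have closed: "zariski_closed22 (orbit22 a)"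
    unfolding zariski_closed22_def
    using poly_fun_char_mat22 poly_fun_diff[OF poly_fun_det[OF poly_fun_mat22] poly_fun.const]
    by (intro exI[of _ "insert (\<lambda>b. det (mat22 b) - det (mat22 a)) ((\<lambda>r b. det (?S b - mat r)) ` {r1, r2, r3})"]) auto
  let ?S' = "mat22 a ** transpose (mat22 a)"
  \<comment> \<open>The left factor of the decomposition diagonalises the other Gram matrix with the
    same eigenvalues, so the centraliser bound also applies to the first component of the
    stabilizer.\<close>
  have "?S' ** P = P ** ?D ** (transpose Q ** Q) ** transpose ?D ** (transpose P ** P)"
    unfolding M matrix_transpose_mul transpose_transpose matrix_mul_assoc ..
  also have "\<dots> = P ** (?D ** transpose ?D)"
    unfolding SO3_D(1)[OF P] SO3_D(1)[OF Q] by (simp add: matrix_mul_assoc)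
  also have "?D ** transpose ?D = diag3 (vector [r1, r2, r3])"
    using d(1,2) d3 by (simp add: diag3_def mat3_simps power2_eq_square)
  finally have S'P: "?S' ** P = P ** diag3 (vector [r1, r2, r3])" .
  define F G where "F = {R \<in> SO3. transpose R ** ?S' ** R = ?S'}" and "G = {R \<in> SO3. transpose R ** ?S a ** R = ?S a}"
  have fin: "finite F" "finite G"
    unfolding F_def G_def
    using finite_SO3_centraliser[OF P ne S'P] finite_SO3_centraliser[OF Q ne SQ] by auto
  have "stabilizer22 a \<subseteq> (\<Union>T\<in>F. {g. spin g = T}) \<times> (\<Union>T\<in>G. {h. spin h = T})"
  proof clarify
    fix g h assume "(g, h) \<in> stabilizer22 a"
    then have g: "spin g \<in> SO3" and h: "spin h \<in> SO3"
      and eq: "transpose (spin g) ** mat22 a ** spin h = mat22 a"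
      by (auto simp: stabilizer22_iff spin_SO3)
    have "transpose (spin g) ** mat22 a ** (spin h ** transpose (spin h)) ** transpose (mat22 a) ** spin g
      = (transpose (spin g) ** mat22 a ** spin h) ** transpose (transpose (spin g) ** mat22 a ** spin h)"
      unfolding matrix_transpose_mul transpose_transpose matrix_mul_assoc ..
    then have "transpose (spin g) ** ?S' ** spin g = ?S'"
      unfolding eq SO3_D(2)[OF h] by (simp add: matrix_mul_assoc)
    moreover have "transpose (spin h) ** transpose (mat22 a) ** (spin g ** transpose (spin g)) ** mat22 a ** spin h
      = transpose (transpose (spin g) ** mat22 a ** spin h) ** (transpose (spin g) ** mat22 a ** spin h)"
      unfolding matrix_transpose_mul transpose_transpose matrix_mul_assoc ..
    then have "transpose (spin h) ** ?S a ** spin h = ?S a"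
      unfolding eq SO3_D(2)[OF g] by (simp add: matrix_mul_assoc)
    ultimately show "g \<in> (\<Union>T\<in>F. {g. spin g = T}) \<and> h \<in> (\<Union>T\<in>G. {h. spin h = T})"
      using g h by (simp add: F_def G_def)
  qed
  then have "finite (stabilizer22 a)"
    by (rule finite_subset) (intro finite_cartesian_product finite_UN_I fin finite_spin_fibre)
  with closed show ?thesis by (simp add: git_stable22_def)
qed

subsection \<open>Stable curves are smooth\<close>

definition torus :: "complex \<Rightarrow> complex^2^2" where
  "torus t = vector [vector [t, 0], vector [0, inverse t]]"

lemma torus_mult_vec: "torus t *v p = vector [t * p$1, inverse t * p$2]"
  by (simp add: torus_def matrix_vector_mult_def vec_eq_iff forall_2 sum_2)

lemma torus_SL2: "t \<noteq> 0 \<Longrightarrow> torus t \<in> SL2"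
  by (simp add: torus_def SL2_def det_2)

lemma SL2_mult: "g \<in> SL2 \<Longrightarrow> h \<in> SL2 \<Longrightarrow> g ** h \<in> SL2"
  by (simp add: SL2_def det_mul)

lemma SL2_inverse:
  assumes "g \<in> SL2"
  obtains k where "k \<in> SL2" "g ** k = mat 1" "k ** g = mat 1"
proof -
  have "invertible g" using assms by (simp add: SL2_def invertible_det_nz)
  then obtain k where k: "g ** k = mat 1" "k ** g = mat 1" unfolding invertible_def by blast
  have "det g * det k = 1" using k(1) by (metis det_I det_mul)
  then show ?thesis using k assms that by (simp add: SL2_def)
qed

lemma SL2_column:
  assumes "p \<noteq> 0"
  obtains g where "g \<in> SL2" "g *v vector [0, 1] = p"
proof (cases "p$2 = 0")
  case True
  then have "p$1 \<noteq> 0" using assms by (simp add: vec_eq_iff forall_2)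
  then show ?thesis
    using True by (intro that[of "vector [vector [0, p$1], vector [- inverse (p$1), 0]]"])
      (simp_all add: SL2_def det_2 matrix_vector_mult_def vec_eq_iff forall_2 sum_2)
next
  case False
  then show ?thesis
    by (intro that[of "vector [vector [inverse (p$2), p$1], vector [0, p$2]]"])
      (simp_all add: SL2_def det_2 matrix_vector_mult_def vec_eq_iff forall_2 sum_2)
qed

text \<open>The chain rule for \<open>conic_spin\<close> in the first coordinate; the coefficients
  are the first column of g.\<close>

lemma spin_conicX:
  "spin g *v conicX (vector [0, 1]) =
    (g$1$1) *s conicX (g *v vector [0, 1]) + (g$2$1) *s conicU (g *v vector [0, 1])"
  by (simp add: spin_def conicX_def conicU_def Let_def vec_eq_iff forall_3
      matrix_vector_mult_def sum_2 sum_3 algebra_simps)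

text \<open>The singular point is pulled back to X = Y = 0, where the form and its derivatives in X
  and Y are exactly these three coefficients.\<close>

lemma singular_point22_translate:
  assumes "singular_point22 a (g *v vector [0, 1]) (h *v vector [0, 1])"
    and b: "\<And>p q. form22 b p q = form22 a (g *v p) (h *v q)"
  shows "b 0 0 = 0" "b 1 0 = 0" "b 0 1 = 0"
proof -
  let ?e = "vector [0, 1] :: complex^2"
  have M: "mat22 b = transpose (spin g) ** mat22 a ** spin h"
    using b by (simp add: mat22_eq_action_iff)
  have form: "cdot x (mat22 b *v y) = cdot (spin g *v x) (mat22 a *v (spin h *v y))" for x y
    unfolding M by (simp only: cdot_matrix_left matrix_vector_mul_assoc matrix_mul_assoc)
  have add: "cdot (x + y) z = cdot x z + cdot y z" "cdot z (x + y) = cdot z x + cdot z y" for x y z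
    by (simp_all add: cdot_def algebra_simps)
  have "form22 b ?e ?e = 0" "dX22 b ?e ?e = 0" "dY22 b ?e ?e = 0"
    using assms(1) unfolding singular_point22_def form22_mat22 dX22_mat22 dU22_mat22 dY22_mat22
      dV22_mat22 form spin_conicX conic_spin[symmetric] vec.add vec.scale add cdot_scale
    by simp_all
  then show "b 0 0 = 0" "b 1 0 = 0" "b 0 1 = 0"
    by (simp_all add: form22_def dX22_def dY22_def sum_atMost_2)
qed

lemma continuous_poly_fun:
  assumes "f \<in> poly_fun" and "\<And>i j. continuous_on X (\<lambda>s. c s i j)"
  shows "continuous_on X (\<lambda>s. f (c s))"
  using assms(1) by induction (auto intro: continuous_intros assms(2))

text \<open>A polynomial is continuous along the curve, so if it vanishes for all nonzero parameters
  it also vanishes at 0.\<close>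

lemma zariski_closed22_limit:
  fixes c :: "complex \<Rightarrow> coeffs"
  assumes "zariski_closed22 Z" and cont: "\<And>i j. continuous_on UNIV (\<lambda>s. c s i j)"
    and Z: "\<And>s. s \<noteq> 0 \<Longrightarrow> c s \<in> Z" and c0: "c 0 \<in> bideg22_space"
  shows "c 0 \<in> Z"
proof -
  obtain P where P: "P \<subseteq> poly_fun" and ZP: "Z = {b \<in> bideg22_space. \<forall>f\<in>P. f b = 0}"
    using assms(1) unfolding zariski_closed22_def by blast
  have "f (c 0) = 0" if f: "f \<in> P" for f
  proof -
    have "continuous_on UNIV (\<lambda>s. f (c s))"
      using continuous_poly_fun cont P f by blast
    then have "((\<lambda>s. f (c s)) \<longlongrightarrow> f (c 0)) (at 0)"
      by (simp add: continuous_on_def)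
    moreover have "\<forall>\<^sub>F s in at 0. f (c s) = 0"
      using Z f unfolding ZP by (auto simp: eventually_at_filter)
    then have "((\<lambda>s. f (c s)) \<longlongrightarrow> 0) (at 0)" by (rule tendsto_eventually)
    ultimately show ?thesis using tendsto_unique by (metis at_neq_bot)
  qed
  then show ?thesis using c0 ZP by blast
qed

lemma stable_imp_smooth:
  assumes "git_stable22 a"
  shows "smooth_biconic a"
proof (rule ccontr)
  assume "\<not> smooth_biconic a"
  then obtain p q where pq: "singular_point22 a p q" by (auto simp: smooth_biconic_def)
  then have "p \<noteq> 0" "q \<noteq> 0" by (simp_all add: singular_point22_def)
  then obtain g h where g: "g \<in> SL2" "g *v vector [0, 1] = p" and h: "h \<in> SL2" "h *v vector [0, 1] = q"
    using SL2_column by metis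
  obtain b where "b \<in> bideg22_space" "mat22 b = transpose (spin g) ** mat22 a ** spin h"
    by (rule mat22_surj)
  then have b: "form22 b p q = form22 a (g *v p) (h *v q)" for p q
    by (simp add: mat22_eq_action_iff)
  have b0: "b 0 0 = 0" "b 1 0 = 0" "b 0 1 = 0"
    using singular_point22_translate[of a g h b] b pq g h by auto
  \<comment> \<open>The substitution \<open>s = t\<^sup>2\<close> makes \<open>c s\<close> the translate of \<open>b\<close> by \<open>torus t\<close>; the truncated exponent is
    harmless because the coefficients with \<open>i + j < 2\<close> vanish.\<close>
  define c :: "complex \<Rightarrow> coeffs" where
    "c s i j = (if i \<le> 2 \<and> j \<le> 2 \<and> 2 \<le> i + j then s ^ (i + j - 2) * b i j else 0)" for s i j
  have c_space: "c s \<in> bideg22_space" for s by (auto simp: c_def bideg22_space_def)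
  have c_torus: "form22 (c (t\<^sup>2)) p q = form22 b (torus t *v p) (torus t *v q)" if "t \<noteq> 0" for t p q
    unfolding form22_def sum_atMost_2 torus_mult_vec using b0 that
    by (simp add: c_def field_simps power2_eq_square)
  have "c s \<in> orbit22 a" if "s \<noteq> 0" for s
  proof -
    define t where "t = csqrt s"
    have t: "t\<^sup>2 = s" "t \<noteq> 0" using that by (auto simp: t_def)
    have "form22 (c s) p q = form22 a ((g ** torus t) *v p) ((h ** torus t) *v q)" for p q
      using c_torus[OF t(2), of p q] unfolding t b by (simp add: matrix_vector_mul_assoc)
    then show ?thesis
      unfolding orbit22_def using c_space SL2_mult[OF _ torus_SL2[OF t(2)]] g h by blast
  qed
  moreover have "continuous_on UNIV (\<lambda>s. c s i j)" for i j
  proof (cases "i \<le> 2 \<and> j \<le> 2 \<and> 2 \<le> i + j")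
    case True
    show ?thesis unfolding c_def if_P[OF True] by (intro continuous_intros)
  next
    case False
    show ?thesis unfolding c_def if_not_P[OF False] by (rule continuous_on_const)
  qed
  \<comment> \<open>Since \<open>0 ^ 0 = 1\<close>, the limit \<open>c 0\<close> keeps exactly the
    coefficients with i + j = 2, which have weight zero under the torus.\<close>
  ultimately have "c 0 \<in> orbit22 a"
    using zariski_closed22_limit[of "orbit22 a" c] c_space assms by (auto simp: git_stable22_def)
  then obtain k l where k: "k \<in> SL2" and l: "l \<in> SL2"
    and kl: "\<And>p q. form22 (c 0) p q = form22 a (k *v p) (l *v q)"
    by (auto simp: orbit22_def)
  obtain k' where k': "k' \<in> SL2" "k ** k' = mat 1" "k' ** k = mat 1" using SL2_inverse[OF k] .
  obtain l' where l': "l' \<in> SL2" "l ** l' = mat 1" "l' ** l = mat 1" using SL2_inverse[OF l] .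
  have c0_torus: "form22 (c 0) (torus t *v p) (torus t *v q) = form22 (c 0) p q" if "t \<noteq> 0" for t p q
    unfolding form22_def sum_atMost_2 torus_mult_vec using that
    by (simp add: c_def field_simps power2_eq_square)
  \<comment> \<open>Since (k, l) carries a to \<open>c 0\<close>, conjugation by it turns the torus
    fixing \<open>c 0\<close> into a one-parameter group fixing a.\<close>
  define \<phi> where "\<phi> t = (k ** torus t ** k', l ** torus t ** l')" for t
  have "\<phi> ` (- {0}) \<subseteq> stabilizer22 a"
  proof (rule image_subsetI)
    fix t :: complex assume "t \<in> - {0}"
    then have t: "t \<noteq> 0" by simp
    have "form22 a ((k ** torus t ** k') *v p) ((l ** torus t ** l') *v q) = form22 a p q" for p q
    proof -
      have "form22 a ((k ** torus t ** k') *v p) ((l ** torus t ** l') *v q)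
        = form22 (c 0) (torus t *v (k' *v p)) (torus t *v (l' *v q))"
        unfolding kl matrix_vector_mul_assoc matrix_mul_assoc ..
      also have "\<dots> = form22 a (k *v (k' *v p)) (l *v (l' *v q))"
        unfolding c0_torus[OF t] by (rule kl)
      finally show ?thesis
        unfolding matrix_vector_mul_assoc k' l' by simp
    qed
    then show "\<phi> t \<in> stabilizer22 a"
      using t k l k' l' by (simp add: \<phi>_def stabilizer22_def SL2_mult torus_SL2)
  qed
  moreover have "inj_on \<phi> (- {0})"
  proof (rule inj_onI)
    fix s t assume "\<phi> s = \<phi> t"
    then have "k' ** (k ** torus s ** k') ** k = k' ** (k ** torus t ** k') ** k"
      by (simp add: \<phi>_def)
    moreover have "k' ** (k ** A ** k') ** k = A" for A
    proof -
      have "k' ** (k ** A ** k') ** k = (k' ** k) ** A ** (k' ** k)" unfolding matrix_mul_assoc ..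
      then show ?thesis unfolding k' by simp
    qed
    ultimately have "torus s $ 1 $ 1 = torus t $ 1 $ 1" by simp
    then show "s = t" by (simp add: torus_def)
  qed
  moreover have "infinite (- {0 :: complex})"
    by (simp add: Compl_eq_Diff_UNIV infinite_UNIV_char_0)
  ultimately have "infinite (stabilizer22 a)"
    using finite_subset finite_image_iff by metis
  then show False using assms by (simp add: git_stable22_def)
qed

theorem mainTheorem8:
  assumes "a \<in> bideg22_space" and "a \<noteq> (\<lambda>_ _. 0)"
  shows "git_stable22 a \<longleftrightarrow> smooth_biconic a"
  using stable_imp_smooth smooth_imp_stable assms(1) by blast

end
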